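(* Let $X$, $Y$, and $Z$ be vector spaces. Let $f\colon Y\to Z$ and $g\colon X\to Z$ be dyadically homogeneous functions, and suppose additionally that $f$ is midpoint injective. If $T\colon X\to Y$ is a map satisfying $$f\bigl(T(x)-T(y)\bigr)=g(x-y)\qquad\text{for all } x,y\in X,$$ then $T$ is $\mathbb{Q}$-affine.
   Context: All vector spaces are real and nontrivial. Maps are not assumed linear or affine unless stated. A map $f\colon V\to W$ between vector spaces is *dyadically homogeneous* if $f(2^k x)=2^k f(x)$ for all $x\in V$ and all $k\in\mathbb{Z}$. A map $f\colon V\to W$ between vector spaces is *midpoint injective* if for all $x,y\in V$: $f(x)=f(y)=f\left(\frac{x+y}{2}\right)$ implies $x=y$. A map $U\colon V\to W$ between vector spaces is *$\mathbb{Q}$-linear* if $U(px+qy)=pU(x)+qU(y)$ for all $p,q\in\mathbb{Q}$ and $x,y\in V$. A map $T\colon V\to W$ is *$\mathbb{Q}$-affine* if $x\mapsto T(x)-T(0)$ is $\mathbb{Q}$-linear. *)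

theory Defs
  imports "HOL-Analysis.Analysis"
begin

definition dyadically_homogeneous :: "('v::real_vector \<Rightarrow> 'w::real_vector) \<Rightarrow> bool" where
  "dyadically_homogeneous f \<longleftrightarrow>
     (\<forall>x. \<forall>k::int. f ((2 powi k) *\<^sub>R x) = (2 powi k) *\<^sub>R f x)"

definition midpoint_injective :: "('v::real_vector \<Rightarrow> 'w::real_vector) \<Rightarrow> bool" where
  "midpoint_injective f \<longleftrightarrow>
     (\<forall>x y. f x = f y \<and> f y = f (midpoint x y) \<longrightarrow> x = y)"

definition rat_linear :: "('v::real_vector \<Rightarrow> 'w::real_vector) \<Rightarrow> bool" where
  "rat_linear U \<longleftrightarrow>
     (\<forall>p q :: rat. \<forall>x y.
        U (of_rat p *\<^sub>R x + of_rat q *\<^sub>R y) = of_rat p *\<^sub>R U x + of_rat q *\<^sub>R U y)"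

definition rat_affine :: "('v::real_vector \<Rightarrow> 'w::real_vector) \<Rightarrow> bool" where
  "rat_affine T \<longleftrightarrow> rat_linear (\<lambda>x. T x - T 0)"

end

theory Submission
  imports Defs
begin

text \<open>The map \<open>T\<close> preserves midpoints: if \<open>m\<close> is the midpoint of \<open>x\<close> and \<open>y\<close>, then the vectors
  \<open>T x - T m\<close>, \<open>T m - T y\<close> and their midpoint \<open>(T x - T y) / 2\<close> all have \<open>f\<close>-value
  \<open>g ((x - y) / 2)\<close>, so the first two agree. Hence \<open>T - T 0\<close> is additive, and additive maps are
  \<open>\<rat>\<close>-linear.\<close>

lemma dyadically_homogeneous_half:
  assumes "dyadically_homogeneous f"
  shows "f ((1/2) *\<^sub>R x) = (1/2) *\<^sub>R f x"
  using assms[unfolded dyadically_homogeneous_def, rule_format, of "-1" x]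
  by (simp add: power_int_minus)

lemma midpoint_preserving:
  assumes f: "dyadically_homogeneous f" and g: "dyadically_homogeneous g"
    and inj: "midpoint_injective f"
    and eq: "\<And>x y. f (T x - T y) = g (x - y)"
  shows "T (midpoint x y) = midpoint (T x) (T y)"
proof -
  let ?m = "midpoint x y"
  have half: "x - ?m = (1/2) *\<^sub>R (x - y)" "?m - y = (1/2) *\<^sub>R (x - y)"
    using scaleR_half_double[of x] scaleR_half_double[of y]
    by (simp_all add: midpoint_def algebra_simps)
  \<comment> \<open>\<open>T ?m\<close> cancels in the sum. The value of \<open>f\<close> at this
    midpoint thus comes from homogeneity of \<open>f\<close> and the equation for \<open>x\<close>,
    \<open>y\<close>; the values at the two endpoints come from homogeneity of
    \<open>g\<close>.\<close>
  have "midpoint (T x - T ?m) (T ?m - T y) = (1/2) *\<^sub>R (T x - T y)"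
    by (simp add: midpoint_def)
  then have "f (midpoint (T x - T ?m) (T ?m - T y)) = (1/2) *\<^sub>R g (x - y)"
    by (simp only: dyadically_homogeneous_half[OF f] eq)
  moreover have "f (T x - T ?m) = (1/2) *\<^sub>R g (x - y)" "f (T ?m - T y) = (1/2) *\<^sub>R g (x - y)"
    by (simp_all only: eq half dyadically_homogeneous_half[OF g])
  ultimately have "T x - T ?m = T ?m - T y"
    using inj unfolding midpoint_injective_def by metis
  then have "T x + T y = 2 *\<^sub>R T ?m"
    by (simp add: scaleR_2 algebra_simps)
  then show ?thesis
    by (simp add: midpoint_def)
qed

text \<open>Midpoints with 0 show that \<open>U\<close> commutes with doubling, and
  \<open>x + y\<close> is the midpoint of \<open>2 *\<^sub>R x\<close> and
  \<open>2 *\<^sub>R y\<close>.\<close>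

lemma midpoint_preserving_imp_additive:
  fixes U :: "'v::real_vector \<Rightarrow> 'w::real_vector"
  assumes mid: "\<And>x y. U (midpoint x y) = midpoint (U x) (U y)" and "U 0 = 0"
  shows "Modules.additive U"
proof
  have double: "U (2 *\<^sub>R x) = 2 *\<^sub>R U x" for x
    using mid[of "2 *\<^sub>R x" 0] \<open>U 0 = 0\<close> by (simp add: midpoint_def)
  show "U (x + y) = U x + U y" for x y
    using mid[of "2 *\<^sub>R x" "2 *\<^sub>R y"] by (simp add: midpoint_def double scaleR_right_distrib)
qed

lemma additive_scaleR_of_int:
  fixes U :: "'v::real_vector \<Rightarrow> 'w::real_vector"
  assumes "Modules.additive U"
  shows "U (of_int k *\<^sub>R x) = of_int k *\<^sub>R U x"
proof -
  interpret Modules.additive U by fact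
  \<comment> \<open>Induction in both directions from 0; the downward step uses that
    \<open>U\<close> respects differences.\<close>
  show ?thesis
    by (induction k rule: int_induct[where k = 0])
       (simp_all add: zero add diff scaleR_left_distrib scaleR_left_diff_distrib)
qed

text \<open>Clear denominators: for \<open>q = a / b\<close>, multiplying either side of the scaling
  law by \<open>b\<close> gives \<open>U (of_int a *\<^sub>R x)\<close>.\<close>

lemma additive_imp_rat_linear:
  fixes U :: "'v::real_vector \<Rightarrow> 'w::real_vector"
  assumes "Modules.additive U"
  shows "rat_linear U"
proof -
  have scale: "U (of_rat q *\<^sub>R x) = of_rat q *\<^sub>R U x" for q :: rat and x
  proof (cases q)
    case (Fract a b)
    let ?z = "of_rat q *\<^sub>R x"
    have b: "(of_int b :: real) * of_rat q = of_int a"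
      using Fract by (simp add: of_rat_rat)
    have "of_int b *\<^sub>R U ?z = U (of_int a *\<^sub>R x)"
      by (simp add: b flip: additive_scaleR_of_int[OF assms])
    also have "\<dots> = of_int b *\<^sub>R (of_rat q *\<^sub>R U x)"
      by (simp add: b additive_scaleR_of_int[OF assms])
    \<comment> \<open>The factor \<open>of_int b\<close> must stay separate from
      \<open>of_rat q\<close> so that it can be cancelled as nonzero.\<close>
    finally show ?thesis
      using \<open>b > 0\<close> by (simp del: scaleR_scaleR)
  qed
  then show ?thesis
    by (simp add: rat_linear_def Modules.additive.add[OF assms])
qed

theorem lemma1p2:
  fixes f :: "'y::real_vector \<Rightarrow> 'z::real_vector"
    and g :: "'x::real_vector \<Rightarrow> 'z"
    and T :: "'x \<Rightarrow> 'y"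
  assumes nontrivial_X: "\<exists>x::'x. x \<noteq> 0"
    and nontrivial_Y: "\<exists>y::'y. y \<noteq> 0"
    and nontrivial_Z: "\<exists>z::'z. z \<noteq> 0"
    and f_homogeneous: "dyadically_homogeneous f"
    and g_homogeneous: "dyadically_homogeneous g"
    and f_injective: "midpoint_injective f"
    and T_eq: "\<And>x y. f (T x - T y) = g (x - y)"
  shows "rat_affine T"
proof -
  \<comment> \<open>Subtracting the constant \<open>T 0\<close> keeps midpoints and makes the value
    at 0 vanish, as additivity requires.\<close>
  have "T (midpoint x y) - T 0 = midpoint (T x - T 0) (T y - T 0)" for x y
    using midpoint_preserving[OF f_homogeneous g_homogeneous f_injective T_eq, of x y]
    by (simp add: midpoint_def algebra_simps flip: scaleR_2)
  then have "Modules.additive (\<lambda>x. T x - T 0)"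
    by (intro midpoint_preserving_imp_additive) simp_all
  then show ?thesis
    unfolding rat_affine_def by (rule additive_imp_rat_linear)
qed

end
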